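(* Let $T_n:\mathbb{C}\times S^1\to\mathbb{C}$, $n\ge 1$, be maps such that, writing $T_{n,\theta}(z):=T_n(z,e^{i\theta})$, the map $T_{n,\theta}-\mathrm{Id}:\mathbb{C}\to\mathbb{C}$ has Lipschitz constant $\mathrm{Lip}(T_{n,\theta}-\mathrm{Id})<4^{-n}$ for all $n$ and all $\theta$. Then $(T_n)$ is an undercooking of the plane: there is a constant $C>0$ independent of $n$ such that $\mathrm{Fav}_{T_n}(\mathcal{K}_n)\ge C\frac{\log n}{n}$ for all $n\ge 2$.
   Context: Middle-half Cantor set: $\mathcal{C}_0=[0,1]$ and $\mathcal{C}_{n+1}$ is obtained from $\mathcal{C}_n$ by replacing each of its intervals by the first and last quarters of that interval. Thus $\mathcal{C}_n$ is a union of $2^n$ intervals of length $4^{-n}$ and $\mathcal{K}_n:=\mathcal{C}_n\times\mathcal{C}_n\subset\mathbb{C}$ is a union of $4^n$ squares of side $4^{-n}$. $\mathrm{Proj}_\theta$ is orthogonal projection onto the line through the origin in direction $e^{i\theta}$, $|\cdot|$ is one-dimensional Lebesgue measure. For $T:\mathbb{C}\times S^1\to\mathbb{C}$, $T_\theta(z):=T(z,e^{i\theta})$ and $\mathrm{Fav}_T(E):=\frac{1}{2\pi}\int_0^{2\pi}|\mathrm{Proj}_\theta(T_\theta(E))|\,d\theta$. *)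

theory Defs
  imports "HOL-Analysis.Analysis"
begin

fun cantor_intervals :: "nat \<Rightarrow> (real \<times> real) set" where
  "cantor_intervals 0 = {(0, 1)}"
| "cantor_intervals (Suc n) =
     (\<Union>(a, b) \<in> cantor_intervals n. {(a, a + (b - a) / 4), (b - (b - a) / 4, b)})"

definition cantor_stage :: "nat \<Rightarrow> real set" where
  "cantor_stage n = (\<Union>(a, b) \<in> cantor_intervals n. {a..b})"

definition cantor_square :: "nat \<Rightarrow> complex set" where
  "cantor_square n = {Complex x y | x y. x \<in> cantor_stage n \<and> y \<in> cantor_stage n}"

definition Proj :: "real \<Rightarrow> complex \<Rightarrow> complex" where
  "Proj \<theta> z = complex_of_real (Re (z * cnj (cis \<theta>))) * cis \<theta>"

text \<open>One-dimensional Lebesgue measure of a subset of the line through 0 in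
  direction e^{i theta}, via the isometric parametrisation t \<mapsto> t e^{i theta}.\<close>
definition line_measure :: "real \<Rightarrow> complex set \<Rightarrow> ennreal" where
  "line_measure \<theta> S = emeasure lebesgue {t. complex_of_real t * cis \<theta> \<in> S}"

text \<open>Favard length of E with respect to T (lower Lebesgue integral over theta).\<close>
definition Fav :: "(complex \<Rightarrow> complex \<Rightarrow> complex) \<Rightarrow> complex set \<Rightarrow> ennreal" where
  "Fav T E = (\<integral>\<^sup>+ \<theta> \<in> {0..2*pi}. line_measure \<theta> (Proj \<theta> ` ((\<lambda>z. T z (cis \<theta>)) ` E)) \<partial>lborel)
             / ennreal (2 * pi)"

end

theory Submission
  imports Defs
begin

text \<open>The proof follows Bateman and Volberg. In the direction of slope 2 the lower-left corners of
  the \<open>4 ^ n\<close> squares of \<open>cantor_square n\<close> project to equally spaced points. Let \<open>\<tau> = 2 ^ -k \<ge> 1 / n\<close> and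
  consider slopes between \<open>2 + \<tau> / 2\<close> and \<open>2 + \<tau>\<close>. Two squares at distance comparable to \<open>4 ^ (m - n)\<close>
  whose shadows overlap for such a slope have indices that are close to, and on both sides of, a
  common multiple of \<open>4 ^ m\<close>, so there are only few of them, and the mean energy of the shadows over
  these slopes is \<open>O(n \<tau>)\<close>. The projection then has mean length at least of order \<open>1 / (n \<tau>)\<close>, so
  each of the about \<open>log n\<close> arcs contributes at least of order \<open>1 / n\<close>. A perturbation with
  Lipschitz constant below \<open>4 ^ -n\<close> moves the shadows of two squares relative to each other by no
  more than the size of a square, which only affects constants.\<close>

section \<open>Corners of the squares and their base 4 indices\<close>

text \<open>Reads the base 4 digits of an index, replacing each digit \<open>d\<close> by \<open>3 * b d\<close>. Digits 0 to 3 number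
  the four corner squares, and the corners of all stages are obtained without reference to the
  stage: the square with index \<open>i < 4 ^ n\<close> has lower-left corner \<open>(corner_x i, corner_y i) / 4 ^ n\<close>.\<close>

fun cantor_code :: "(nat \<Rightarrow> nat) \<Rightarrow> nat \<Rightarrow> nat" where
  "cantor_code b i = (if i = 0 then 0 else 4 * cantor_code b (i div 4) + 3 * b (i mod 4))"

declare cantor_code.simps [simp del]

abbreviation corner_x :: "nat \<Rightarrow> nat" where
  "corner_x \<equiv> cantor_code (\<lambda>d. d mod 2)"

abbreviation corner_y :: "nat \<Rightarrow> nat" where
  "corner_y \<equiv> cantor_code (\<lambda>d. d div 2)"

lemma cantor_code_0 [simp]: "cantor_code b 0 = 0"
  by (simp add: cantor_code.simps)

lemma cantor_code_rec:
  assumes "b 0 = 0"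
  shows "cantor_code b i = 4 * cantor_code b (i div 4) + 3 * b (i mod 4)"
  using assms by (cases "i = 0") (auto simp: cantor_code.simps[of b i])

text \<open>Each digit satisfies \<open>d mod 2 + 2 * (d div 2) = d\<close>, so slope 2 recombines
  the two coordinate digits into the index itself. This is the equal spacing of the projected
  corners.\<close>

lemma corner_x_plus_2_corner_y: "corner_x i + 2 * corner_y i = 3 * i"
proof (induction i rule: less_induct)
  case (less i)
  show ?case
  proof (cases "i = 0")
    case False
    then have "corner_x (i div 4) + 2 * corner_y (i div 4) = 3 * (i div 4)"
      by (intro less) auto
    moreover have "(i mod 4) mod 2 + 2 * ((i mod 4) div 2) = i mod 4"
      by presburger
    moreover have "4 * (i div 4) + i mod 4 = i" by simp
    moreover have "corner_x i = 4 * corner_x (i div 4) + 3 * (i mod 4 mod 2)"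
      "corner_y i = 4 * corner_y (i div 4) + 3 * (i mod 4 div 2)"
      by (rule cantor_code_rec; simp)+
    ultimately show ?thesis by linarith
  qed simp
qed

text \<open>The \<open>m\<close> lowest digits contribute at most
  \<open>3 * (1 + 4 + ... + 4 ^ (m - 1)) = 4 ^ m - 1\<close>. Geometrically, in units of the
  smallest squares, a square lies inside its ancestor of side \<open>4 ^ m\<close>, whose index is
  \<open>i div 4 ^ m\<close>.\<close>

lemma cantor_code_prefix:
  assumes "b 0 = 0" and "\<And>d. d < 4 \<Longrightarrow> b d \<le> 1"
  shows "4 ^ m * cantor_code b (i div 4 ^ m) \<le> cantor_code b i \<and>
         cantor_code b i < 4 ^ m * cantor_code b (i div 4 ^ m) + 4 ^ m"
proof (induction m)
  case (Suc m)
  define k where "k = i div 4 ^ m"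
  have k: "cantor_code b k = 4 * cantor_code b (k div 4) + 3 * b (k mod 4)"
    by (rule cantor_code_rec) fact
  have d: "k div 4 = i div 4 ^ Suc m"
    by (simp only: k_def div_mult2_eq power_Suc2)
  have "b (k mod 4) \<le> 1" using assms(2) by simp
  then have "4 ^ m * (4 * cantor_code b (k div 4)) \<le> 4 ^ m * cantor_code b k"
    "4 ^ m * (cantor_code b k + 1) \<le> 4 ^ m * (4 * cantor_code b (k div 4) + 4)"
    using k by (intro mult_le_mono; linarith)+
  then have "4 * (4 ^ m * cantor_code b (k div 4)) \<le> 4 ^ m * cantor_code b k"
    "4 ^ m * cantor_code b k + 4 ^ m \<le> 4 * (4 ^ m * cantor_code b (k div 4)) + 4 * 4 ^ m"
    by (simp_all only: algebra_simps)
  with Suc show ?case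
    unfolding k_def[symmetric] d[symmetric] unfolding power_Suc mult.assoc by linarith
qed simp

lemma cantor_code_diff_less:
  assumes "b 0 = 0" and "\<And>d. d < 4 \<Longrightarrow> b d \<le> 1" and "i div 4 ^ m = j div 4 ^ m"
  shows "\<bar>real (cantor_code b i) - real (cantor_code b j)\<bar> < 4 ^ m"
proof -
  have *: "cantor_code b i < cantor_code b j + 4 ^ m" "cantor_code b j < cantor_code b i + 4 ^ m"
    using cantor_code_prefix[where b = b, OF assms(1,2), of m i] cantor_code_prefix[where b = b, OF assms(1,2), of m j] assms(3)
    by auto
  have "real (cantor_code b i) < real (cantor_code b j + 4 ^ m)"
       "real (cantor_code b j) < real (cantor_code b i + 4 ^ m)"
    using * by (simp_all only: of_nat_less_iff)
  then show ?thesis by simp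
qed

text \<open>The leading differing digit contributes \<open>3 * 4 ^ m\<close>, and the lower digits
  can take back less than \<open>4 ^ m\<close>. What remains is the removed middle half.\<close>

lemma cantor_code_diff_ge:
  assumes b: "b 0 = 0" "\<And>d. d < 4 \<Longrightarrow> b d \<le> 1"
    and "i div 4 ^ Suc m = j div 4 ^ Suc m"
    and "b (i div 4 ^ m mod 4) \<noteq> b (j div 4 ^ m mod 4)"
  shows "\<bar>real (cantor_code b i) - real (cantor_code b j)\<bar> \<ge> 2 * 4 ^ m"
proof -
  have *: "cantor_code b i \<ge> cantor_code b j + 2 * 4 ^ m"
    if eq: "i div 4 ^ Suc m = j div 4 ^ Suc m"
      and less: "b (j div 4 ^ m mod 4) < b (i div 4 ^ m mod 4)" for i j
  proof -
    define k l where "k = i div 4 ^ m" and "l = j div 4 ^ m"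
    have "k div 4 = l div 4"
      using eq by (simp only: k_def l_def div_mult2_eq power_Suc2)
    moreover have "b (l mod 4) = 0" "b (k mod 4) = 1"
      using less b(2)[of "k mod 4"] b(2)[of "l mod 4"] by (auto simp: k_def l_def)
    ultimately have "cantor_code b k = cantor_code b l + 3"
      using cantor_code_rec[where b = b, OF b(1), of k] cantor_code_rec[where b = b, OF b(1), of l] by simp
    then show ?thesis
      using cantor_code_prefix[where b = b, OF b, of m i] cantor_code_prefix[where b = b, OF b, of m j]
      by (simp add: k_def l_def algebra_simps)
  qed
  have "cantor_code b i \<ge> cantor_code b j + 2 * 4 ^ m \<or> cantor_code b j \<ge> cantor_code b i + 2 * 4 ^ m"
    using *[of i j] *[of j i] assms(3,4) by (metis linorder_neqE_nat)
  then have "real (cantor_code b i) \<ge> real (cantor_code b j + 2 * 4 ^ m) \<or>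
             real (cantor_code b j) \<ge> real (cantor_code b i + 2 * 4 ^ m)"
    by (simp only: of_nat_le_iff)
  then show ?thesis by auto
qed

lemma corner_separation:
  assumes "i div 4 ^ Suc m = j div 4 ^ Suc m" and "i div 4 ^ m \<noteq> j div 4 ^ m"
  shows "\<bar>real (corner_x i) - real (corner_x j)\<bar> \<ge> 2 * 4 ^ m \<or>
         \<bar>real (corner_y i) - real (corner_y j)\<bar> \<ge> 2 * 4 ^ m"
proof -
  have "i div 4 ^ m div 4 = j div 4 ^ m div 4"
    using assms(1) by (simp only: div_mult2_eq power_Suc2)
  then have "i div 4 ^ m mod 4 \<noteq> j div 4 ^ m mod 4"
    using assms(2) by (metis div_mult_mod_eq)
  then have "i div 4 ^ m mod 4 mod 2 \<noteq> j div 4 ^ m mod 4 mod 2 \<or>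
             i div 4 ^ m mod 4 div 2 \<noteq> j div 4 ^ m mod 4 div 2"
    by (metis div_mult_mod_eq)
  moreover have "d mod 2 \<le> 1" "d < 4 \<Longrightarrow> d div 2 \<le> 1" for d :: nat
    by auto
  ultimately show ?thesis
    using cantor_code_diff_ge[of "\<lambda>d. d mod 2" i m j, OF _ _ assms(1)]
      cantor_code_diff_ge[of "\<lambda>d. d div 2" i m j, OF _ _ assms(1)] by simp blast
qed

text \<open>\<open>cantor_intervals\<close> subdivides at the finest scale, which matches the lowest
  digit: \<open>b (i mod 4)\<close> being 0 or 1 selects the first or the last quarter, and the last
  quarter starts 3 new units further on.\<close>

lemma cantor_code_in_cantor_intervals:
  assumes b: "b 0 = 0" "\<And>d. d < 4 \<Longrightarrow> b d \<le> 1" and "i < 4 ^ n"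
  shows "(real (cantor_code b i) / 4 ^ n, (real (cantor_code b i) + 1) / 4 ^ n) \<in> cantor_intervals n"
  using assms(3)
proof (induction n arbitrary: i)
  case (Suc n)
  define k where "k = i div 4"
  have k: "cantor_code b i = 4 * cantor_code b k + 3 * b (i mod 4)"
    unfolding k_def by (rule cantor_code_rec) fact
  have "k < 4 ^ n" using Suc.prems by (auto simp: k_def)
  note IH = Suc.IH[OF this]
  have "b (i mod 4) = 0 \<or> b (i mod 4) = 1" using b(2)[of "i mod 4"] by auto
  then show ?case
    unfolding cantor_intervals.simps
    by (intro UN_I[OF IH]) (auto simp: k field_simps)
qed simp

lemma finite_cantor_intervals: "finite (cantor_intervals n)"
  by (induction n) auto

lemma compact_cantor_square: "compact (cantor_square n)"
proof -
  have "compact (cantor_stage n)"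
    unfolding cantor_stage_def by (intro compact_UN finite_cantor_intervals) auto
  then have "compact ((\<lambda>p. Complex (fst p) (snd p)) ` (cantor_stage n \<times> cantor_stage n))"
    by (intro compact_continuous_image compact_Times)
       (auto simp: Complex_eq intro!: continuous_intros)
  moreover have "(\<lambda>p. Complex (fst p) (snd p)) ` (cantor_stage n \<times> cantor_stage n) = cantor_square n"
    by (force simp: cantor_square_def)
  ultimately show ?thesis by simp
qed

text \<open>One edge can stand for the whole square: for slopes between 2 and 3 a vertical edge has
  a shadow comparable to its length, and on a segment the intermediate value theorem applies after
  the perturbation.\<close>

lemma left_edge_subset_cantor_square:
  assumes "i < 4 ^ n" "real (corner_y i) / 4 ^ n \<le> y" "y \<le> (real (corner_y i) + 1) / 4 ^ n"
  shows "Complex (real (corner_x i) / 4 ^ n) y \<in> cantor_square n"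
proof -
  have 1: "(real (corner_x i) / 4 ^ n, (real (corner_x i) + 1) / 4 ^ n) \<in> cantor_intervals n"
    by (rule cantor_code_in_cantor_intervals) (use assms in auto)
  have 2: "(real (corner_y i) / 4 ^ n, (real (corner_y i) + 1) / 4 ^ n) \<in> cantor_intervals n"
    by (rule cantor_code_in_cantor_intervals) (use assms in auto)
  have "real (corner_x i) / 4 ^ n \<in> cantor_stage n"
    unfolding cantor_stage_def by (intro UN_I[OF 1]) (auto simp: divide_simps)
  moreover have "y \<in> cantor_stage n"
    unfolding cantor_stage_def by (intro UN_I[OF 2]) (use assms in auto)
  ultimately show ?thesis by (auto simp: cantor_square_def)
qed

section \<open>Length of a projection from the number of overlapping shadows\<close>

text \<open>With \<open>g\<close> the multiplicity function of the intervals, \<open>2 * c * g - (c * g)\<^sup>2 \<le> 1\<close>, with value 0 off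
  the union. This replaces the Cauchy-Schwarz inequality by a bound that is linear in the number
  of overlapping pairs, hence easy to integrate over the angle.\<close>

lemma measure_UN_intervals_ge:
  fixes v :: "'a \<Rightarrow> real" and c l :: real
  assumes "finite I" "l \<ge> 0"
  shows "2 * c * l * real (card I) - c\<^sup>2 * l * real (card {(i, j). i \<in> I \<and> j \<in> I \<and> \<bar>v i - v j\<bar> \<le> l})
    \<le> measure lborel (\<Union>i\<in>I. {v i..v i + l})"
proof -
  let ?A = "\<lambda>i. {v i..v i + l}"
  let ?U = "\<Union>i\<in>I. ?A i"
  define g where "g x = (\<Sum>i\<in>I. indicator (?A i) x :: real)" for x
  have g2: "(g x)\<^sup>2 = (\<Sum>(i, j)\<in>I \<times> I. indicator (?A i \<inter> ?A j) x)" for x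
    by (simp add: g_def power2_eq_square sum_product sum.cartesian_product indicator_inter_arith del: Int_atLeastAtMost)
  have fin: "emeasure lborel (?A i) < \<infinity>" for i
    using assms by simp
  have fin2: "emeasure lborel (?A i \<inter> ?A j) < \<infinity>" for i j
    by (simp add: emeasure_lborel_Icc_eq)
  have finU: "emeasure lborel ?U < \<infinity>"
    by (rule emeasure_bounded_finite) (use assms in \<open>auto\<close>)
  have ig: "integrable lborel g" unfolding g_def
    by (intro Bochner_Integration.integrable_sum integrable_real_indicator) (use fin in auto)
  have ig2: "integrable lborel (\<lambda>x. (g x)\<^sup>2)" unfolding g2 split_def
    by (intro Bochner_Integration.integrable_sum integrable_real_indicator) (use fin2 in auto)
  have "integral\<^sup>L lborel g = l * real (card I)"
    unfolding g_def using assms fin by (subst Bochner_Integration.integral_sum) auto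
  moreover have "integral\<^sup>L lborel (\<lambda>x. (g x)\<^sup>2) = (\<Sum>(i, j)\<in>I \<times> I. measure lborel (?A i \<inter> ?A j))"
    unfolding g2 split_def using fin2 by (subst Bochner_Integration.integral_sum) auto
  moreover have "\<dots> \<le> (\<Sum>(i, j)\<in>I \<times> I. if \<bar>v i - v j\<bar> \<le> l then l else 0)"
    by (intro sum_mono) (use assms in \<open>auto simp: content_real_if\<close>)
  moreover have "\<dots> = l * real (card {(i, j). i \<in> I \<and> j \<in> I \<and> \<bar>v i - v j\<bar> \<le> l})"
  proof -
    have "{(i, j). i \<in> I \<and> j \<in> I \<and> \<bar>v i - v j\<bar> \<le> l} = {p \<in> I \<times> I. \<bar>v (fst p) - v (snd p)\<bar> \<le> l}"
      by auto
    then show ?thesis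
      using assms by (simp add: split_def sum.If_cases Int_def)
  qed
  ultimately have "integral\<^sup>L lborel (\<lambda>x. 2 * c * g x - c\<^sup>2 * (g x)\<^sup>2) \<ge>
     2 * c * (l * real (card I)) - c\<^sup>2 * (l * real (card {(i, j). i \<in> I \<and> j \<in> I \<and> \<bar>v i - v j\<bar> \<le> l}))"
    using ig ig2 by (auto intro!: mult_left_mono)
  moreover have "integral\<^sup>L lborel (\<lambda>x. 2 * c * g x - c\<^sup>2 * (g x)\<^sup>2) \<le> integral\<^sup>L lborel (indicator ?U :: real \<Rightarrow> real)"
  proof (rule integral_mono)
    fix x
    show "2 * c * g x - c\<^sup>2 * (g x)\<^sup>2 \<le> (indicator ?U x :: real)"
    proof (cases "x \<in> ?U")
      case True
      have "0 \<le> (c * g x - 1)\<^sup>2" by simp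
      with True show ?thesis by (simp add: power2_eq_square algebra_simps)
    next
      case False
      then have "g x = 0" unfolding g_def by (intro sum.neutral) (auto simp: indicator_def)
      with False show ?thesis by simp
    qed
  qed (use ig ig2 finU assms in \<open>auto intro!: integrable_real_indicator\<close>)
  moreover have "integral\<^sup>L lborel (indicator ?U :: real \<Rightarrow> real) = measure lborel ?U"
    by simp
  ultimately show ?thesis by (simp add: algebra_simps)
qed

lemma line_measure_Proj:
  "line_measure \<theta> (Proj \<theta> ` E) = emeasure lebesgue ((\<lambda>z. Re (z * cnj (cis \<theta>))) ` E)"
proof -
  have "{t. complex_of_real t * cis \<theta> \<in> Proj \<theta> ` E} = (\<lambda>z. Re (z * cnj (cis \<theta>))) ` E"
    by (auto simp: Proj_def simp del: times_complex.sel)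
  then show ?thesis by (simp add: line_measure_def)
qed

text \<open>Each perturbed edge covers an interval of fixed length \<open>l\<close> starting at the
  projected image of its corner. If two such intervals meet, then the unperturbed corners are nearly
  aligned, so the count on the left is free of \<open>S\<close> and can be integrated over the
  angle. The parameter \<open>c\<close> is optimised later.\<close>

lemma line_measure_perturbed_cantor_square_ge:
  fixes S :: "complex \<Rightarrow> complex" and c s L :: real
  assumes n: "n \<ge> 2" and s: "2 \<le> s" "s \<le> 3"
    and L: "L < (1/4) ^ n" "L-lipschitz_on UNIV (\<lambda>z. S z - z)"
  shows "ennreal (c - c\<^sup>2 / (2 * 4 ^ n) * real (card {(i, j). i < 4 ^ n \<and> j < 4 ^ n \<and>
            \<bar>(real (corner_x i) - real (corner_x j)) + s * (real (corner_y i) - real (corner_y j))\<bar> \<le> 8}))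
    \<le> line_measure (arctan s) (Proj (arctan s) ` (S ` cantor_square n))"
proof -
  define \<theta> where "\<theta> = arctan s"
  define p where "p z = Re (z * cnj (cis \<theta>))" for z
  define N :: real where "N = 4 ^ n"
  have N: "N \<ge> 16" "(4::real) ^ n = N" "(1/4::real) ^ n = 1 / N"
    using power_increasing[OF n, of "4::real"] by (simp_all add: N_def power_one_over)
  have p_eq: "p z = Re z * cos \<theta> + Im z * sin \<theta>" for z
    by (simp add: p_def)
  have p_diff: "p (z - w) = p z - p w" for z w
    by (simp add: p_eq algebra_simps)
  have p_le: "\<bar>p z\<bar> \<le> cmod z" for z
    using abs_Re_le_cmod[of "z * cnj (cis \<theta>)"] by (simp only: p_def norm_mult complex_mod_cnj norm_cis mult_1_right)
  have L0: "0 \<le> L" using L(2) by (auto simp: lipschitz_on_def)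
  \<comment> \<open>Only differences of projected points enter below, and these are controlled by
    the Lipschitz constant of \<open>S - Id\<close> even if \<open>S\<close> moves points
    far.\<close>
  have S_diff: "\<bar>(p (S z) - p (S w)) - p (z - w)\<bar> \<le> L * cmod (z - w)" for z w
  proof -
    have "(p (S z) - p (S w)) - p (z - w) = p ((S z - z) - (S w - w))"
      by (simp add: p_diff)
    also have "\<bar>\<dots>\<bar> \<le> cmod ((S z - z) - (S w - w))" by (rule p_le)
    also have "\<dots> \<le> L * cmod (z - w)"
      using lipschitz_onD[OF L(2), of z w] by (simp add: dist_norm)
    finally show ?thesis .
  qed
  have S_cont: "continuous_on A S" for A
  proof -
    have "continuous_on UNIV (\<lambda>z. (S z - z) + z)"
      by (intro continuous_on_add lipschitz_on_continuous_on[OF L(2)] continuous_intros)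
    then show ?thesis using continuous_on_subset by auto
  qed
  have p_cont: "continuous_on A p" for A
    unfolding p_def by (intro continuous_intros)
  define r where "r = sqrt (1 + s\<^sup>2)"
  have cos: "cos \<theta> = 1 / r" and sin: "sin \<theta> = s / r"
    by (simp_all add: \<theta>_def r_def cos_arctan sin_arctan)
  have s2: "4 \<le> s\<^sup>2" "s\<^sup>2 \<le> 9"
    using power_mono[OF s(1), of 2] power_mono[OF s(2), of 2] s by auto
  have r: "1 \<le> r" "r \<le> 32 / 10" "3 / 4 \<le> s / r"
  proof -
    show r1: "1 \<le> r" using s2 by (simp add: r_def)
    show "r \<le> 32 / 10"
      unfolding r_def by (rule real_le_lsqrt) (use s2 in \<open>auto simp: power2_eq_square\<close>)
    have "r \<le> (4/3) * s"
      unfolding r_def by (rule real_le_lsqrt) (use s2 s in \<open>auto simp: power_mult_distrib power2_eq_square\<close>)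
    then show "3 / 4 \<le> s / r" using r1 by (simp add: field_simps)
  qed
  define z where "z i = Complex (real (corner_x i) / N) (real (corner_y i) / N)" for i
  define v where "v i = p (S (z i))" for i
  \<comment> \<open>The shadow of an unperturbed edge has length at least
    \<open>3 / (4 * N)\<close>. Since \<open>n \<ge> 2\<close> gives \<open>L \<le> 1 / 16\<close>,
    the perturbation costs at most \<open>1 / (16 * N)\<close>, which leaves more than
    \<open>l\<close>.\<close>
  define l where "l = 1 / (2 * N)"
  have l: "l \<ge> 0" using N(1) by (simp add: l_def)
  let ?K = "(\<lambda>w. p (S w)) ` cantor_square n"
  have "compact ?K"
    by (intro compact_continuous_image compact_cantor_square continuous_on_compose2[OF p_cont S_cont]) auto
  then have K: "?K \<in> sets borel" by (rule borel_compact)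
  have sub: "{v i..v i + l} \<subseteq> ?K" if i: "i < 4 ^ n" for i
  proof
    fix t assume t: "t \<in> {v i..v i + l}"
    define e where "e y = Complex (real (corner_x i) / N) y" for y
    define y0 y1 where "y0 = real (corner_y i) / N" and "y1 = (real (corner_y i) + 1) / N"
    have y01: "y0 \<le> y1" "y1 - y0 = 1 / N" using N(1) by (simp_all add: y0_def y1_def field_simps)
    have "v i = p (S (e y0))" by (simp add: v_def z_def e_def y0_def)
    moreover have "p (S (e y0)) + l \<le> p (S (e y1))"
    proof -
      have d: "e y1 - e y0 = Complex 0 (1 / N)"
        using y01 by (simp add: e_def complex_eq_iff)
      have "cmod (e y1 - e y0) = 1 / N"
        using N(1) unfolding d by (simp add: cmod_def)
      moreover have "L \<le> 1 / 16"
        using L(1) frac_le[of 1 1 16 N] N(1) unfolding N(3) by linarith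
      ultimately have "L * cmod (e y1 - e y0) \<le> 1 / 16 * (1 / N)"
        using mult_right_mono[of L "1 / 16" "1 / N"] N(1) by simp
      moreover have "p (e y1 - e y0) \<ge> 3 / 4 * (1 / N)"
        using mult_right_mono[OF r(3), of "1 / N"] N(1) unfolding d by (simp add: p_eq sin mult.commute)
      moreover have "l = 1 / 2 * (1 / N)" "1 / N \<ge> 0" using N(1) by (simp_all add: l_def)
      ultimately show ?thesis
        using S_diff[of "e y1" "e y0"] by linarith
    qed
    moreover have "continuous_on {y0..y1} (\<lambda>y. p (S (e y)))"
      unfolding e_def Complex_eq
      by (intro continuous_on_compose2[OF p_cont continuous_on_compose2[OF S_cont]] continuous_intros) auto
    ultimately obtain y where "y0 \<le> y" "y \<le> y1" "p (S (e y)) = t"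
      using IVT'[of "\<lambda>y. p (S (e y))" y0 t y1] t y01 by auto
    moreover from this have "e y \<in> cantor_square n"
      unfolding e_def N(2)[symmetric]
      by (intro left_edge_subset_cantor_square i) (simp_all add: y0_def y1_def N)
    ultimately show "t \<in> ?K" by force
  qed
  let ?close = "\<lambda>i j. \<bar>(real (corner_x i) - real (corner_x j)) + s * (real (corner_y i) - real (corner_y j))\<bar> \<le> 8"
  \<comment> \<open>The corners are at distance at most 2, so the perturbation shifts them relative
    to each other by at most \<open>2 / N\<close>. Adding \<open>l\<close> gives
    \<open>5 / (2 * N)\<close>; rescaling by \<open>r * N\<close> with
    \<open>r \<le> 32 / 10\<close> produces the constant 8.\<close>
  have close: "?close i j" if ij: "i < 4 ^ n" "j < 4 ^ n" and v: "\<bar>v i - v j\<bar> \<le> l" for i j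
  proof -
    define dx dy where "dx = real (corner_x i) - real (corner_x j)"
      and "dy = real (corner_y i) - real (corner_y j)"
    have dxy: "\<bar>dx\<bar> < N" "\<bar>dy\<bar> < N"
      unfolding dx_def dy_def N_def by (rule cantor_code_diff_less; use ij in auto)+
    have d: "z i - z j = Complex (dx / N) (dy / N)"
      by (simp add: z_def dx_def dy_def complex_eq_iff diff_divide_distrib)
    have "cmod (z i - z j) \<le> \<bar>dx / N\<bar> + \<bar>dy / N\<bar>"
      using cmod_le[of "z i - z j"] unfolding d by simp
    moreover have "\<bar>dx / N\<bar> \<le> 1" "\<bar>dy / N\<bar> \<le> 1"
      using dxy N(1) by (simp_all add: abs_divide)
    ultimately have "cmod (z i - z j) \<le> 2"
      by linarith
    then have "L * cmod (z i - z j) \<le> 1 / N * 2"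
      using L(1) N(1) L0 unfolding N(3) by (intro mult_mono) auto
    moreover have l2: "l = 1 / 2 * (1 / N)" "5 / (2 * N) = 5 / 2 * (1 / N)"
      by (simp_all add: l_def)
    ultimately have "\<bar>p (z i - z j)\<bar> \<le> 5 / (2 * N)"
      using S_diff[of "z i" "z j"] v l2 unfolding v_def by linarith
    moreover have "p (z i - z j) = (dx + s * dy) / (r * N)"
      using N(1) r unfolding d by (simp add: p_eq cos sin field_simps)
    ultimately have "\<bar>dx + s * dy\<bar> / (r * N) \<le> 5 / (2 * N)"
      using N(1) r by (simp add: abs_mult)
    then have "\<bar>dx + s * dy\<bar> \<le> 5 / 2 * r"
      using N(1) r by (simp add: field_simps)
    also have "\<dots> \<le> 8" using r by simp
    finally show ?thesis by (simp add: dx_def dy_def)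
  qed
  let ?P = "{(i, j). i < 4 ^ n \<and> j < 4 ^ n \<and> ?close i j}"
  let ?V = "{(i, j). i \<in> {..<4 ^ n} \<and> j \<in> {..<4 ^ n} \<and> \<bar>v i - v j\<bar> \<le> l}"
  let ?U = "\<Union>i\<in>{..<4 ^ n}. {v i..v i + l}"
  have "finite ?P" by (rule finite_subset[of _ "{..<4 ^ n} \<times> {..<4 ^ n}"]) auto
  moreover have "?V \<subseteq> ?P" using close by auto
  ultimately have "card ?V \<le> card ?P" by (rule card_mono)
  then have "c\<^sup>2 * l * real (card ?V) \<le> c\<^sup>2 * l * real (card ?P)"
    using l by (intro mult_left_mono) auto
  moreover have "2 * c * l * real (card {..<(4::nat) ^ n}) = c"
    using N by (simp add: l_def)
  moreover have eq: "c\<^sup>2 / (2 * 4 ^ n) = c\<^sup>2 * l"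
    by (simp add: l_def N)
  ultimately have "c - c\<^sup>2 / (2 * 4 ^ n) * real (card ?P) \<le> measure lborel ?U"
    using measure_UN_intervals_ge[where I = "{..<4 ^ n}" and c = c and v = v, OF finite_lessThan l] unfolding eq by linarith
  then have "ennreal (c - c\<^sup>2 / (2 * 4 ^ n) * real (card ?P)) \<le> ennreal (measure lborel ?U)"
    by (rule ennreal_leI)
  also have "\<dots> = emeasure lborel ?U"
  proof (rule emeasure_eq_ennreal_measure[symmetric])
    have "emeasure lborel ?U < \<infinity>" by (rule emeasure_bounded_finite) auto
    then show "emeasure lborel ?U \<noteq> top" by simp
  qed
  also have "\<dots> \<le> emeasure lborel ?K"
    using sub K by (intro emeasure_mono) auto
  also have "\<dots> = line_measure \<theta> (Proj \<theta> ` (S ` cantor_square n))"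
    using K unfolding line_measure_Proj p_def[symmetric] by (simp add: image_image)
  finally show ?thesis by (simp add: \<theta>_def)
qed

section \<open>Arcs of slopes and the angles at which two squares overlap\<close>

text \<open>The derivative of \<open>arctan\<close> lies between 1/10 and 1 on
  \<open>{0..3}\<close>, so slopes and angles are interchangeable up to constants.\<close>

lemma arctan_diff_bounds:
  fixes a b :: real
  assumes "0 \<le> a" "a \<le> b" "b \<le> 3"
  shows "(b - a) / 10 \<le> arctan b - arctan a" and "arctan b - arctan a \<le> b - a"
proof -
  have "(b - a) / 10 \<le> arctan b - arctan a \<and> arctan b - arctan a \<le> b - a"
  proof (cases "a = b")
    case False
    then obtain x where x: "a < x" "x < b" "arctan b - arctan a = (b - a) * inverse (1 + x\<^sup>2)"
      using MVT2[of a b arctan "\<lambda>x. inverse (1 + x\<^sup>2)"] DERIV_arctan assms by auto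
    have "x\<^sup>2 \<le> 3\<^sup>2" using x assms by (intro power_mono) auto
    then have "inverse 10 \<le> inverse (1 + x\<^sup>2)" "inverse (1 + x\<^sup>2) \<le> 1"
      by (auto simp: field_simps add_nonneg_pos add_pos_nonneg)
    then have "(b - a) * inverse 10 \<le> (b - a) * inverse (1 + x\<^sup>2)"
      "(b - a) * inverse (1 + x\<^sup>2) \<le> (b - a) * 1"
      using assms by (intro mult_left_mono; simp)+
    then show ?thesis using x(3) by (simp add: field_simps)
  qed simp
  then show "(b - a) / 10 \<le> arctan b - arctan a" "arctan b - arctan a \<le> b - a" by auto
qed

lemma measure_le_of_diameter:
  fixes A :: "real set"
  assumes "\<And>x y. x \<in> A \<Longrightarrow> y \<in> A \<Longrightarrow> \<bar>x - y\<bar> \<le> D" and "0 \<le> D" and "A \<in> sets borel"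
  shows "measure lborel A \<le> 2 * D"
proof (cases "A = {}")
  case False
  then obtain x where "x \<in> A" by auto
  then have "A \<subseteq> {x - D..x + D}" using assms(1) by (force simp: abs_le_iff)
  then have "measure lborel A \<le> measure lborel {x - D..x + D}"
    by (rule measure_mono_fmeasurable)
       (use assms in \<open>auto intro!: fmeasurableI simp: emeasure_lborel_Icc_eq\<close>)
  then show ?thesis using assms by simp
qed (use assms in auto)

text \<open>Half open, so that the arcs for \<tau> = 1, 1/2, 1/4, ... abut without sharing an
  endpoint.\<close>

definition slope_arc :: "real \<Rightarrow> real set" where
  "slope_arc \<tau> = {arctan (2 + \<tau> / 2)<..arctan (2 + \<tau>)}"

lemma slope_arc_tan:
  assumes "\<theta> \<in> slope_arc \<tau>"
  shows "\<theta> = arctan (tan \<theta>)" "2 + \<tau> / 2 < tan \<theta>" "tan \<theta> \<le> 2 + \<tau>"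
proof -
  have "- (pi / 2) < \<theta>" "\<theta> < pi / 2"
    using assms arctan_bounded[of "2 + \<tau> / 2"] arctan_bounded[of "2 + \<tau>"] by (auto simp: slope_arc_def)
  then show *: "\<theta> = arctan (tan \<theta>)" by (simp add: arctan_tan)
  show "2 + \<tau> / 2 < tan \<theta>" "tan \<theta> \<le> 2 + \<tau>"
    using assms arctan_less_iff[of "2 + \<tau> / 2" "tan \<theta>"] arctan_le_iff[of "tan \<theta>" "2 + \<tau>"] *
    by (auto simp: slope_arc_def)
qed

lemma measure_slope_arc_bounds:
  assumes "0 < \<tau>" "\<tau> \<le> 1"
  shows "\<tau> / 20 \<le> measure lborel (slope_arc \<tau>)" "measure lborel (slope_arc \<tau>) \<le> \<tau> / 2"
  using arctan_diff_bounds[of "2 + \<tau> / 2" "2 + \<tau>"] assms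
  by (auto simp: slope_arc_def measure_def field_simps)

text \<open>The overlap condition for a fixed pair as a set of angles. Summing the measures of these
  sets over all pairs gives the overlap count integrated over the arc.\<close>

definition close_angles :: "real \<Rightarrow> nat \<Rightarrow> nat \<Rightarrow> real set" where
  "close_angles \<tau> i j = {\<theta> \<in> slope_arc \<tau>.
     \<bar>(real (corner_x i) - real (corner_x j)) + tan \<theta> * (real (corner_y i) - real (corner_y j))\<bar> \<le> 8}"

lemma borel_slope_arc [measurable]: "slope_arc \<tau> \<in> sets borel"
  by (simp add: slope_arc_def)

lemma borel_close_angles [measurable]: "close_angles \<tau> i j \<in> sets borel"
proof -
  have [measurable]: "(\<lambda>\<theta>. tan \<theta> :: real) \<in> borel_measurable borel"
    unfolding tan_def by measurable
  have "close_angles \<tau> i j = slope_arc \<tau> \<inter> {\<theta> \<in> space borel. \<bar>(real (corner_x i) - real (corner_x j)) +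
      tan \<theta> * (real (corner_y i) - real (corner_y j))\<bar> \<le> 8}"
    by (auto simp: close_angles_def)
  also have "\<dots> \<in> sets borel"
    by (intro sets.Int borel_slope_arc) measurable
  finally show ?thesis .
qed

lemma fmeasurable_slope_arc: "slope_arc \<tau> \<in> fmeasurable lborel"
  using emeasure_bounded_finite[of "slope_arc \<tau>"] by (auto intro!: fmeasurableI simp: slope_arc_def)

lemma measure_close_angles_le:
  assumes "0 < \<tau>" "\<tau> \<le> 1"
  shows "measure lborel (close_angles \<tau> i j) \<le> \<tau> / 2"
proof -
  have "measure lborel (close_angles \<tau> i j) \<le> measure lborel (slope_arc \<tau>)"
    by (rule measure_mono_fmeasurable[OF _ _ fmeasurable_slope_arc])
       (use borel_close_angles in \<open>auto simp: close_angles_def\<close>)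
  then show ?thesis using measure_slope_arc_bounds[OF assms] by simp
qed

text \<open>Transversality: as a function of the slope \<open>s\<close>, the offset
  \<open>dx + s * dy\<close> changes at rate \<open>dy\<close>, which has order
  \<open>4 ^ m\<close>. Staying within 8 of zero confines \<open>s\<close> to a range of length
  \<open>16 / (4 ^ m / 3)\<close>, and passing from diameter to measure doubles this. For
  \<open>m < 2\<close> the bound exceeds the length of the arc.\<close>

lemma measure_close_angles_le_separation:
  assumes \<tau>: "0 < \<tau>" "\<tau> \<le> 1"
    and m: "i div 4 ^ Suc m = j div 4 ^ Suc m" "i div 4 ^ m \<noteq> j div 4 ^ m"
  shows "measure lborel (close_angles \<tau> i j) \<le> 96 / 4 ^ m"
proof (cases "m \<ge> 2")
  case False
  then have "(4::real) ^ m \<le> 4 ^ 1" by (intro power_increasing) auto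
  then have "1 \<le> 96 / (4::real) ^ m" by (simp add: field_simps)
  then show ?thesis using measure_close_angles_le[OF \<tau>, of i j] \<tau> by linarith
next
  case True
  define dx dy where "dx = real (corner_x i) - real (corner_x j)"
    and "dy = real (corner_y i) - real (corner_y j)"
  have 16: "(4::real) ^ m \<ge> 16"
    using power_increasing[OF True, of "4::real"] by simp
  have sep: "\<bar>dx\<bar> \<ge> 2 * 4 ^ m \<or> \<bar>dy\<bar> \<ge> 2 * 4 ^ m"
    unfolding dx_def dy_def by (rule corner_separation[OF m])
  have "\<bar>\<theta> - \<phi>\<bar> \<le> 48 / 4 ^ m" if \<theta>: "\<theta> \<in> close_angles \<tau> i j" and \<phi>: "\<phi> \<in> close_angles \<tau> i j" for \<theta> \<phi>
  proof -
    define s t where "s = tan \<theta>" and "t = tan \<phi>"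
    have s: "\<theta> = arctan s" "2 < s" "s \<le> 3" "\<bar>dx + s * dy\<bar> \<le> 8"
      using \<theta> slope_arc_tan[of \<theta> \<tau>] \<tau> by (auto simp: close_angles_def s_def dx_def dy_def)
    have t: "\<phi> = arctan t" "2 < t" "t \<le> 3" "\<bar>dx + t * dy\<bar> \<le> 8"
      using \<phi> slope_arc_tan[of \<phi> \<tau>] \<tau> by (auto simp: close_angles_def t_def dx_def dy_def)
    have "\<bar>s * dy\<bar> \<le> 3 * \<bar>dy\<bar>" using s by (auto simp: abs_mult intro: mult_right_mono)
    \<comment> \<open>If \<open>dx\<close> is the large coordinate, near cancellation forces
      \<open>3 * \<bar>dy\<bar> \<ge> 2 * 4 ^ m - 8\<close>, and \<open>4 ^ m \<ge> 16\<close>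
      absorbs the 8.\<close>
    then have dy: "\<bar>dy\<bar> \<ge> 4 ^ m / 3" using sep s(4) 16 by linarith
    have "\<bar>s - t\<bar> * \<bar>dy\<bar> = \<bar>(dx + s * dy) - (dx + t * dy)\<bar>"
      by (simp add: abs_mult[symmetric] algebra_simps)
    also have "\<dots> \<le> 16" using s(4) t(4) by linarith
    finally have "\<bar>s - t\<bar> * (4 ^ m / 3) \<le> 16"
      using mult_left_mono[OF dy, of "\<bar>s - t\<bar>"] by linarith
    then have "\<bar>s - t\<bar> \<le> 48 / 4 ^ m" by (simp add: field_simps)
    moreover have "\<bar>arctan s - arctan t\<bar> \<le> \<bar>s - t\<bar>"
    proof (cases "s \<le> t")
      case True
      then have "arctan s \<le> arctan t" by (simp add: arctan_le_iff)
      then show ?thesis using arctan_diff_bounds(2)[of s t] s t True by auto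
    next
      case False
      then have "arctan t \<le> arctan s" by (simp add: arctan_le_iff)
      then show ?thesis using arctan_diff_bounds(2)[of t s] s t False by auto
    qed
    ultimately show ?thesis using s t by simp
  qed
  then show ?thesis using measure_le_of_diameter[of "close_angles \<tau> i j" "48 / 4 ^ m"] by simp
qed

text \<open>At slope 2 the offset of the two corners is exactly \<open>3 * (i - j)\<close>. Turning
  to slope \<open>2 + t\<close> with \<open>0 < t \<le> \<tau>\<close> changes it by
  \<open>t * dy\<close>, hence by at most \<open>4 * \<tau> * 4 ^ m\<close>.\<close>

lemma close_angles_empty:
  assumes \<tau>: "0 < \<tau>" "\<tau> \<le> 1" and m: "i div 4 ^ Suc m = j div 4 ^ Suc m"
    and far: "3 * \<bar>real i - real j\<bar> > 8 + 4 * \<tau> * 4 ^ m"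
  shows "close_angles \<tau> i j = {}"
proof -
  define dx dy where "dx = real (corner_x i) - real (corner_x j)"
    and "dy = real (corner_y i) - real (corner_y j)"
  have eq: "dx + 2 * dy = 3 * (real i - real j)"
    using arg_cong[OF corner_x_plus_2_corner_y[of i], of real]
      arg_cong[OF corner_x_plus_2_corner_y[of j], of real]
    by (simp add: dx_def dy_def)
  have dy: "\<bar>dy\<bar> \<le> 4 * 4 ^ m"
    using cantor_code_diff_less[of "\<lambda>d. d div 2" i "Suc m" j, OF _ _ m] unfolding dy_def by force
  have False if \<theta>: "\<theta> \<in> close_angles \<tau> i j" for \<theta>
  proof -
    define t where "t = tan \<theta> - 2"
    have t: "0 < t" "t \<le> \<tau>" "\<bar>dx + (2 + t) * dy\<bar> \<le> 8"
      using \<theta> slope_arc_tan[of \<theta> \<tau>] \<tau> by (auto simp: close_angles_def t_def dx_def dy_def)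
    have "\<bar>t * dy\<bar> \<le> \<tau> * (4 * 4 ^ m)"
      unfolding abs_mult using t dy \<tau> by (intro mult_mono) auto
    moreover have "3 * (real i - real j) = (dx + (2 + t) * dy) - t * dy"
      using eq by (simp add: algebra_simps)
    ultimately show False using t(3) far by linarith
  qed
  then show ?thesis by auto
qed

section \<open>Counting close pairs and the mean energy over an arc\<close>

text \<open>A close pair of indices with different quotients by \<open>q\<close> lies on both sides of a multiple
  of \<open>q\<close>, and both members are near it; this makes the count quadratic in \<open>R\<close>.\<close>

lemma card_straddling_pairs_le:
  fixes q k R :: nat
  shows "card {(i, j). i < k * q \<and> j < k * q \<and> i div q \<noteq> j div q \<and> \<bar>int i - int j\<bar> \<le> int R} \<le> 2 * k * R\<^sup>2"
proof -
  define S where "S = {(i, j). i < j \<and> j < k * q \<and> i div q \<noteq> j div q \<and> j \<le> i + R}"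
  \<comment> \<open>A pair is encoded by the block of its larger member, the offset in that block
    and the gap minus 1. The block boundary lies between the two members, so the offset is below
    \<open>R\<close>; the gap lies between 1 and \<open>R\<close>.\<close>
  define f where "f p = (snd p div q, snd p mod q, snd p - fst p - 1)" for p :: "nat \<times> nat"
  let ?A = "{(i, j). i < k * q \<and> j < k * q \<and> i div q \<noteq> j div q \<and> \<bar>int i - int j\<bar> \<le> int R}"
  have fin: "finite S"
    unfolding S_def by (rule finite_subset[of _ "{..<k * q} \<times> {..<k * q}"]) auto
  have inj: "inj_on f S"
  proof (rule inj_onI)
    fix x y assume xy: "x \<in> S" "y \<in> S" "f x = f y"
    then have "snd x = snd y" unfolding f_def by (metis Pair_inject div_mult_mod_eq)
    with xy show "x = y" by (auto simp: f_def S_def)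
  qed
  have img: "f ` S \<subseteq> {..<k} \<times> ({..<R} \<times> {..<R})"
  proof (rule image_subsetI)
    fix x assume "x \<in> S"
    then obtain i j where x: "x = (i, j)"
      and *: "i < j" "j < k * q" "i div q \<noteq> j div q" "j \<le> i + R" by (auto simp: S_def)
    have "i div q < j div q" using * div_le_mono[of i j q] by simp
    then have "i < j div q * q"
      by (metis div_less_iff_less_mult gr_zeroI mult_0_right not_less_zero *(2))
    moreover have "j = j div q * q + j mod q" by simp
    ultimately have "j mod q < R" using * by linarith
    then show "f x \<in> {..<k} \<times> ({..<R} \<times> {..<R})"
      using * by (auto simp: x f_def less_mult_imp_div_less)
  qed
  have "card S \<le> card ({..<k} \<times> ({..<R} \<times> {..<R}))"
    by (rule card_inj_on_le[OF inj img]) simp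
  then have S: "card S \<le> k * R\<^sup>2" by (simp add: card_cartesian_product power2_eq_square)
  have "?A \<subseteq> S \<union> prod.swap ` S"
  proof
    fix x assume "x \<in> ?A"
    then obtain i j where x: "x = (i, j)"
      and *: "i < k * q" "j < k * q" "i div q \<noteq> j div q" "\<bar>int i - int j\<bar> \<le> int R" by auto
    then have "(i, j) \<in> S \<or> (j, i) \<in> S"
      by (cases i j rule: linorder_cases) (auto simp: S_def)
    then show "x \<in> S \<union> prod.swap ` S" unfolding x by (metis UnCI image_eqI swap_simp)
  qed
  then have "card ?A \<le> card (S \<union> prod.swap ` S)"
    using fin by (intro card_mono) auto
  also have "\<dots> \<le> card S + card (prod.swap ` S)" by (rule card_Un_le)
  also have "\<dots> \<le> card S + card S" using card_image_le[OF fin] by simp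
  finally show ?thesis using S by simp
qed

lemma sum_sum_if_eq_card:
  fixes c :: real
  assumes "finite A" "finite B"
  shows "(\<Sum>i\<in>A. \<Sum>j\<in>B. if P i j then c else 0) = real (card {p \<in> A \<times> B. P (fst p) (snd p)}) * c"
proof -
  have "(\<Sum>i\<in>A. \<Sum>j\<in>B. if P i j then c else 0) = (\<Sum>p\<in>A \<times> B. if P (fst p) (snd p) then c else 0)"
    by (subst sum.cartesian_product) (simp add: split_def)
  then show ?thesis using assms by (simp add: sum.If_cases Int_def)
qed

text \<open>Each off-diagonal pair is charged to the highest level \<open>m\<close> at which its
  quotients differ. That level has of order
  \<open>4 ^ (n - m) * (1 + \<tau> * 4 ^ m)\<^sup>2\<close> pairs, each of measure of order at most
  \<open>min \<tau> (1 / 4 ^ m)\<close>, so it contributes of order at most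
  \<open>4 ^ n * (\<tau> / 4 ^ m + \<tau>\<^sup>2)\<close>. The first terms form a geometric series;
  the second ones add up to \<open>n * \<tau>\<^sup>2\<close>.\<close>

lemma sum_measure_close_angles_le:
  assumes \<tau>: "0 < \<tau>" "\<tau> \<le> 1" "1 \<le> real n * \<tau>"
  shows "(\<Sum>i<4 ^ n. \<Sum>j<4 ^ n. measure lborel (close_angles \<tau> i j)) \<le> 800 * real n * \<tau>\<^sup>2 * 4 ^ n"
proof -
  define b :: "nat \<Rightarrow> real" where "b m = min (\<tau> / 2) (96 / 4 ^ m)" for m
  define near where "near m i j \<longleftrightarrow> i div 4 ^ m \<noteq> j div 4 ^ m \<and> 3 * \<bar>real i - real j\<bar> \<le> 8 + 4 * \<tau> * 4 ^ m"
    for m i j :: nat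
  have b0: "0 \<le> b m" for m using \<tau> by (simp add: b_def)
  have pair: "measure lborel (close_angles \<tau> i j) \<le>
      (if i = j then \<tau> / 2 else 0) + (\<Sum>m<n. if near m i j then b m else 0)"
    if ij: "i < 4 ^ n" "j < 4 ^ n" for i j
  proof (cases "i = j")
    case True
    have "0 \<le> (\<Sum>m<n. if near m i j then b m else 0)" using b0 by (intro sum_nonneg) auto
    then show ?thesis using measure_close_angles_le[OF \<tau>(1,2), of i j] True by simp
  next
    case False
    \<comment> \<open>\<open>M\<close> is the level of the smallest common ancestor. It is positive
      because \<open>i \<noteq> j\<close>, and one level below it the ancestors are
      distinct.\<close>
    define M where "M = (LEAST M. i div 4 ^ M = j div 4 ^ M)"
    have n: "i div 4 ^ n = j div 4 ^ n" using ij by simp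
    have M: "i div 4 ^ M = j div 4 ^ M" "M \<le> n"
      unfolding M_def by (rule LeastI[of "\<lambda>M. i div 4 ^ M = j div 4 ^ M", OF n])
        (rule Least_le[of "\<lambda>M. i div 4 ^ M = j div 4 ^ M", OF n])
    then obtain m where m: "M = Suc m" using False by (cases M) auto
    have ne: "i div 4 ^ m \<noteq> j div 4 ^ m"
      using not_less_Least[of m "\<lambda>M. i div 4 ^ M = j div 4 ^ M"] m by (simp add: M_def)
    have "measure lborel (close_angles \<tau> i j) \<le> (if near m i j then b m else 0)"
    proof (cases "near m i j")
      case True
      then show ?thesis
        using measure_close_angles_le[OF \<tau>(1,2), of i j]
          measure_close_angles_le_separation[OF \<tau>(1,2) _ ne] M m by (simp add: b_def)
    next
      case False
      then have "close_angles \<tau> i j = {}"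
        using M m ne by (intro close_angles_empty[OF \<tau>(1,2), of i m j]) (auto simp: near_def)
      then show ?thesis using False by simp
    qed
    also have "\<dots> \<le> (\<Sum>m<n. if near m i j then b m else 0)"
      by (rule member_le_sum[of m "{..<n}" "\<lambda>m. if near m i j then b m else 0"])
        (use M m b0 in auto)
    finally show ?thesis using False by simp
  qed
  have level: "(\<Sum>i<4 ^ n. \<Sum>j<4 ^ n. if near m i j then b m else 0)
      \<le> 4 ^ n * (15 * \<tau> * (1 / 4) ^ m + 684 * \<tau>\<^sup>2)" if m: "m < n" for m
  proof -
    define q where "q = (4::real) ^ m"
    define R where "R = nat \<lfloor>(8 + 4 * \<tau> * q) / 3\<rfloor>"
    have q: "1 \<le> q" by (simp add: q_def)
    have pow: "(4::nat) ^ n = 4 ^ (n - m) * 4 ^ m"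
      using m by (simp flip: power_add)
    have powr: "(4::real) ^ (n - m) = 4 ^ n / q"
      using m by (simp add: q_def power_diff)
    have R: "real R \<le> (8 + 4 * \<tau> * q) / 3"
      using \<tau> q unfolding R_def by (intro of_nat_floor) auto
    have "(real R)\<^sup>2 \<le> ((8 + 4 * \<tau> * q) / 3)\<^sup>2"
      using R by (intro power_mono) auto
    also have "\<dots> \<le> (128 + 32 * \<tau>\<^sup>2 * q\<^sup>2) / 9"
      using zero_le_power2[of "8 - 4 * \<tau> * q"] by (simp add: power2_eq_square algebra_simps)
    finally have R2: "(real R)\<^sup>2 \<le> (128 + 32 * \<tau>\<^sup>2 * q\<^sup>2) / 9" .
    let ?N = "{p \<in> {..<4 ^ n} \<times> {..<4 ^ n}. near m (fst p) (snd p)}"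
    let ?A = "{(i, j). i < 4 ^ (n - m) * 4 ^ m \<and> j < 4 ^ (n - m) * 4 ^ m \<and>
        i div 4 ^ m \<noteq> j div 4 ^ m \<and> \<bar>int i - int j\<bar> \<le> int R}"
    have "?N \<subseteq> ?A"
    proof
      fix x assume "x \<in> ?N"
      then obtain i j where x: "x = (i, j)" and ij: "i < 4 ^ n" "j < 4 ^ n" and "near m i j"
        by auto
      then have *: "i div 4 ^ m \<noteq> j div 4 ^ m" "\<bar>real i - real j\<bar> \<le> (8 + 4 * \<tau> * q) / 3"
        by (auto simp: near_def q_def)
      from *(2) have "real_of_int \<bar>int i - int j\<bar> \<le> (8 + 4 * \<tau> * q) / 3" by simp
      then have "\<bar>int i - int j\<bar> \<le> \<lfloor>(8 + 4 * \<tau> * q) / 3\<rfloor>" by (simp add: le_floor_iff)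
      then have "\<bar>int i - int j\<bar> \<le> int R" unfolding R_def by linarith
      with *(1) ij show "x \<in> ?A" by (simp add: x pow)
    qed
    moreover have "finite ?A"
      by (rule finite_subset[of _ "{..<4 ^ (n - m) * 4 ^ m} \<times> {..<4 ^ (n - m) * 4 ^ m}"]) auto
    ultimately have "card ?N \<le> card ?A" by (intro card_mono)
    also have "\<dots> \<le> 2 * 4 ^ (n - m) * R\<^sup>2" by (rule card_straddling_pairs_le)
    finally have "real (card ?N) \<le> real (2 * 4 ^ (n - m) * R\<^sup>2)" by (simp only: of_nat_le_iff)
    then have card: "real (card ?N) \<le> 2 * (4 ^ n / q) * (real R)\<^sup>2"
      by (simp add: powr)
    have "(\<Sum>i<4 ^ n. \<Sum>j<4 ^ n. if near m i j then b m else 0) = real (card ?N) * b m"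
      by (rule sum_sum_if_eq_card) auto
    also have "\<dots> \<le> 2 * (4 ^ n / q) * (real R)\<^sup>2 * b m"
      using card b0 by (rule mult_right_mono)
    also have "\<dots> \<le> 2 * (4 ^ n / q) * ((128 + 32 * \<tau>\<^sup>2 * q\<^sup>2) / 9) * b m"
      using R2 b0 q by (intro mult_right_mono mult_left_mono) auto
    also have "\<dots> = 4 ^ n * (256 / 9 * b m / q + 64 / 9 * \<tau>\<^sup>2 * (b m * q))"
      using q by (simp add: field_simps power2_eq_square)
    \<comment> \<open>The two bounds in the minimum \<open>b m\<close> are used separately:
      \<open>\<tau> / 2\<close> in the first term, \<open>96 / q\<close> in the second.\<close>
    also have "\<dots> \<le> 4 ^ n * (15 * \<tau> * (1 / 4) ^ m + 684 * \<tau>\<^sup>2)"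
    proof (intro mult_left_mono add_mono)
      have "256 / 9 * b m \<le> 15 * \<tau>" using \<tau> by (simp add: b_def min_def)
      then have "256 / 9 * b m / q \<le> 15 * \<tau> / q" using q by (intro divide_right_mono) auto
      then show "256 / 9 * b m / q \<le> 15 * \<tau> * (1 / 4) ^ m"
        by (simp add: q_def power_one_over)
      have "b m \<le> 96 / q" by (simp add: b_def q_def)
      then have "b m * q \<le> 96" using q by (simp add: field_simps)
      then have "64 / 9 * \<tau>\<^sup>2 * (b m * q) \<le> 64 / 9 * \<tau>\<^sup>2 * 96" by (intro mult_left_mono) auto
      also have "\<dots> \<le> 684 * \<tau>\<^sup>2" by simp
      finally show "64 / 9 * \<tau>\<^sup>2 * (b m * q) \<le> 684 * \<tau>\<^sup>2" .
    qed simp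
    finally show ?thesis .
  qed
  have geo: "(\<Sum>m<n. (1 / 4 :: real) ^ m) \<le> 4 / 3"
    by (subst sum_gp_strict) (simp add: field_simps)
  have "(\<Sum>i<4 ^ n. \<Sum>j<4 ^ n. measure lborel (close_angles \<tau> i j)) \<le>
     (\<Sum>i<4 ^ n. \<Sum>j<4 ^ n. (if i = j then \<tau> / 2 else 0) + (\<Sum>m<n. if near m i j then b m else 0))"
    by (intro sum_mono pair) auto
  also have "\<dots> = 4 ^ n * (\<tau> / 2) + (\<Sum>i<4 ^ n. \<Sum>j<4 ^ n. \<Sum>m<n. if near m i j then b m else 0)"
    by (simp add: sum.distrib)
  also have "(\<Sum>i<4 ^ n. \<Sum>j<4 ^ n. \<Sum>m<n. if near m i j then b m else 0)
      = (\<Sum>m<n. \<Sum>i<4 ^ n. \<Sum>j<4 ^ n. if near m i j then b m else 0)"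
    by (subst sum.swap, subst sum.swap) (intro sum.cong refl sum.swap)
  also have "\<dots> \<le> (\<Sum>m<n. 4 ^ n * (15 * \<tau> * (1 / 4) ^ m + 684 * \<tau>\<^sup>2))"
    by (intro sum_mono level) auto
  also have "\<dots> = 4 ^ n * (15 * \<tau> * (\<Sum>m<n. (1 / 4) ^ m) + real n * (684 * \<tau>\<^sup>2))"
    by (simp add: sum.distrib flip: sum_distrib_left)
  also have "\<dots> \<le> 4 ^ n * (15 * \<tau> * (4 / 3) + real n * (684 * \<tau>\<^sup>2))"
    using geo \<tau> by (intro mult_left_mono add_right_mono) auto
  finally have *: "(\<Sum>i<4 ^ n. \<Sum>j<4 ^ n. measure lborel (close_angles \<tau> i j)) \<le>
      4 ^ n * (\<tau> / 2 + 20 * \<tau> + real n * (684 * \<tau>\<^sup>2))"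
    by (simp add: algebra_simps)
  \<comment> \<open>The assumption \<open>1 \<le> real n * \<tau>\<close> lets the diagonal and the
    geometric series be absorbed into the main term.\<close>
  have "1 * \<tau> \<le> real n * \<tau> * \<tau>" using \<tau> by (intro mult_right_mono) auto
  then have "\<tau> \<le> real n * \<tau>\<^sup>2" by (simp add: power2_eq_square mult.assoc)
  then have "\<tau> / 2 + 20 * \<tau> + real n * (684 * \<tau>\<^sup>2) \<le> 800 * real n * \<tau>\<^sup>2"
    using \<tau> by linarith
  then have "4 ^ n * (\<tau> / 2 + 20 * \<tau> + real n * (684 * \<tau>\<^sup>2)) \<le> 4 ^ n * (800 * real n * \<tau>\<^sup>2)"
    by (rule mult_left_mono) simp
  with * show ?thesis by (simp only: mult.commute)
qed

section \<open>Lower bound for the integral over one arc\<close>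

text \<open>Under the integral \<open>ennreal\<close> truncates negative values to 0, which can only
  increase it. The minorants below may change sign.\<close>

lemma ennreal_integral_le_nn_integral:
  fixes f :: "'a \<Rightarrow> real"
  assumes "integrable M f"
  shows "ennreal (integral\<^sup>L M f) \<le> (\<integral>\<^sup>+ x. ennreal (f x) \<partial>M)"
proof -
  have max: "integrable M (\<lambda>x. max 0 (f x))"
    using assms by (intro integrable_max) auto
  have "integral\<^sup>L M f \<le> integral\<^sup>L M (\<lambda>x. max 0 (f x))"
    using assms max by (intro integral_mono) auto
  then have "ennreal (integral\<^sup>L M f) \<le> ennreal (integral\<^sup>L M (\<lambda>x. max 0 (f x)))"
    by (rule ennreal_leI)
  also have "\<dots> = (\<integral>\<^sup>+ x. ennreal (max 0 (f x)) \<partial>M)"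
    using max by (intro nn_integral_eq_integral[symmetric]) auto
  also have "\<dots> = (\<integral>\<^sup>+ x. ennreal (f x) \<partial>M)"
    by (intro nn_integral_cong) (auto simp: max_def ennreal_neg)
  finally show ?thesis .
qed

text \<open>An explicit simple function of the angle. The perturbation may depend on the angle
  arbitrarily, so the line measure is integrated only through this measurable lower bound. It
  vanishes off its arc, so the bounds for several arcs can be added.\<close>

definition arc_minorant :: "nat \<Rightarrow> real \<Rightarrow> real \<Rightarrow> real \<Rightarrow> real" where
  "arc_minorant n \<tau> c \<theta> = c * indicator (slope_arc \<tau>) \<theta>
     - c\<^sup>2 / (2 * 4 ^ n) * (\<Sum>i<4 ^ n. \<Sum>j<4 ^ n. indicator (close_angles \<tau> i j) \<theta>)"

lemma close_angles_subset: "close_angles \<tau> i j \<subseteq> slope_arc \<tau>"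
  by (auto simp: close_angles_def)

lemma arc_minorant_eq_0:
  assumes "\<theta> \<notin> slope_arc \<tau>"
  shows "arc_minorant n \<tau> c \<theta> = 0"
proof -
  have "indicator (close_angles \<tau> i j) \<theta> = (0::real)" for i j
    using assms close_angles_subset[of \<tau> i j] by (auto simp: indicator_def)
  then show ?thesis using assms by (simp add: arc_minorant_def)
qed

lemma arc_minorant_le_line_measure:
  assumes "n \<ge> 2" "0 < \<tau>" "\<tau> \<le> 1" "\<theta> \<in> slope_arc \<tau>"
    and "L < (1/4) ^ n" "L-lipschitz_on UNIV (\<lambda>z. S z - z)"
  shows "ennreal (arc_minorant n \<tau> c \<theta>) \<le> line_measure \<theta> (Proj \<theta> ` (S ` cantor_square n))"
proof -
  define s where "s = tan \<theta>"
  have s: "\<theta> = arctan s" "2 \<le> s" "s \<le> 3"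
    using slope_arc_tan[OF assms(4)] assms(2,3) by (auto simp: s_def)
  let ?close = "\<lambda>i j. \<bar>(real (corner_x i) - real (corner_x j)) + s * (real (corner_y i) - real (corner_y j))\<bar> \<le> 8"
  have "indicator (close_angles \<tau> i j) \<theta> = (if ?close i j then 1 else 0 :: real)" for i j
    using assms(4) by (auto simp: close_angles_def s_def indicator_def)
  then have sum_eq: "(\<Sum>i<4 ^ n. \<Sum>j<4 ^ n. indicator (close_angles \<tau> i j) \<theta> :: real) =
      real (card {p \<in> {..<4 ^ n} \<times> {..<4 ^ n}. ?close (fst p) (snd p)})"
    using sum_sum_if_eq_card[of "{..<4 ^ n}" "{..<4 ^ n}" ?close 1] by simp
  have set_eq: "{p \<in> {..<4 ^ n} \<times> {..<4 ^ n}. ?close (fst p) (snd p)} =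
      {(i, j). i < 4 ^ n \<and> j < 4 ^ n \<and> ?close i j}"
    by auto
  have "arc_minorant n \<tau> c \<theta> =
      c - c\<^sup>2 / (2 * 4 ^ n) * real (card {(i, j). i < 4 ^ n \<and> j < 4 ^ n \<and> ?close i j})"
    unfolding arc_minorant_def sum_eq set_eq using assms(4) by simp
  then show ?thesis
    using line_measure_perturbed_cantor_square_ge[OF assms(1) s(2,3) assms(5,6), of c]
    unfolding s(1)[symmetric] by (simp only:)
qed

lemma arc_minorant_integral:
  shows integrable_arc_minorant: "integrable lborel (arc_minorant n \<tau> c)"
    and integral_arc_minorant: "integral\<^sup>L lborel (arc_minorant n \<tau> c) = c * measure lborel (slope_arc \<tau>)
      - c\<^sup>2 / (2 * 4 ^ n) * (\<Sum>i<4 ^ n. \<Sum>j<4 ^ n. measure lborel (close_angles \<tau> i j))"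
proof -
  have "close_angles \<tau> i j \<in> fmeasurable lborel" for i j
    using fmeasurable_slope_arc[of \<tau>] close_angles_subset[of \<tau> i j]
    by (rule fmeasurableI2) simp
  then have 1: "integrable lborel (indicator (close_angles \<tau> i j) :: real \<Rightarrow> real)" for i j
    by (intro integrable_real_indicator) (auto simp: fmeasurable_def)
  have 2: "integrable lborel (indicator (slope_arc \<tau>) :: real \<Rightarrow> real)"
    using fmeasurable_slope_arc[of \<tau>] by (intro integrable_real_indicator) (auto simp: fmeasurable_def)
  show "integrable lborel (arc_minorant n \<tau> c)"
    unfolding arc_minorant_def
    by (intro Bochner_Integration.integrable_diff integrable_mult_right Bochner_Integration.integrable_sum 1 2)
  show "integral\<^sup>L lborel (arc_minorant n \<tau> c) = c * measure lborel (slope_arc \<tau>)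
      - c\<^sup>2 / (2 * 4 ^ n) * (\<Sum>i<4 ^ n. \<Sum>j<4 ^ n. measure lborel (close_angles \<tau> i j))"
    unfolding arc_minorant_def using 1 2
    by (subst Bochner_Integration.integral_diff)
       (auto intro!: integrable_mult_right Bochner_Integration.integrable_sum simp: Bochner_Integration.integral_sum)
qed

text \<open>The integral is at least
  \<open>c * \<tau> / 20 - 400 * c\<^sup>2 * n * \<tau>\<^sup>2\<close>, and the chosen
  \<open>c\<close> maximises this expression. The maximum does not depend on \<tau>, so every arc
  contributes equally.\<close>

lemma integral_arc_minorant_ge:
  assumes \<tau>: "0 < \<tau>" "\<tau> \<le> 1" "1 \<le> real n * \<tau>"
  shows "1 / (640000 * real n) \<le> integral\<^sup>L lborel (arc_minorant n \<tau> (1 / (16000 * real n * \<tau>)))"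
proof -
  define c where "c = 1 / (16000 * real n * \<tau>)"
  have n: "0 < real n" using \<tau> by (cases n) auto
  have "c * (\<tau> / 20) \<le> c * measure lborel (slope_arc \<tau>)"
    using measure_slope_arc_bounds[OF \<tau>(1,2)] \<tau> by (intro mult_left_mono) (auto simp: c_def)
  moreover have "c\<^sup>2 / (2 * 4 ^ n) * (\<Sum>i<4 ^ n. \<Sum>j<4 ^ n. measure lborel (close_angles \<tau> i j))
      \<le> c\<^sup>2 / (2 * 4 ^ n) * (800 * real n * \<tau>\<^sup>2 * 4 ^ n)"
    by (intro mult_left_mono sum_measure_close_angles_le \<tau>) auto
  moreover have "c * (\<tau> / 20) - c\<^sup>2 / (2 * 4 ^ n) * (800 * real n * \<tau>\<^sup>2 * 4 ^ n) = 1 / (640000 * real n)"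
    using n \<tau> by (simp add: c_def field_simps power2_eq_square)
  ultimately show ?thesis
    unfolding integral_arc_minorant c_def[symmetric] by linarith
qed

section \<open>Summation over the dyadic arcs\<close>

lemma disjoint_slope_arcs:
  assumes "\<theta> \<in> slope_arc ((1/2) ^ k)" "\<theta> \<in> slope_arc ((1/2) ^ l)"
  shows "k = l"
proof -
  have *: False if "k < l" "\<theta> \<in> slope_arc ((1/2) ^ k)" "\<theta> \<in> slope_arc ((1/2) ^ l)" for k l
  proof -
    have "(1/2::real) ^ l \<le> (1/2) ^ Suc k" using that by (intro power_decreasing) auto
    then show False using slope_arc_tan(2)[OF that(2)] slope_arc_tan(3)[OF that(3)] by simp
  qed
  show ?thesis using *[of k l] *[of l k] assms by (cases k l rule: linorder_cases) auto
qed

theorem theorem3: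
  fixes T :: "nat \<Rightarrow> complex \<Rightarrow> complex \<Rightarrow> complex"
  assumes lip: "\<And>n \<theta>. n \<ge> 1 \<Longrightarrow>
      \<exists>L < (1/4) ^ n. L-lipschitz_on UNIV (\<lambda>z. T n z (cis \<theta>) - z)"
  shows "\<exists>C > 0. \<forall>n \<ge> 2. Fav (T n) (cantor_square n) \<ge> ennreal (C * ln (real n) / real n)"
\<comment> \<open>The contribution of one arc is \<open>1 / (640000 * n)\<close>; the factor
  \<open>2 * pi\<close> is the normalisation in \<open>Fav\<close>.\<close>
proof (intro exI[of _ "1 / (640000 * (2 * pi))"] conjI allI impI)
  fix n :: nat assume n: "n \<ge> 2"
  \<comment> \<open>The number of usable arcs: every \<open>k < K\<close> has
    \<open>2 ^ k \<le> n\<close>, as the energy bound requires, while \<open>n < 2 ^ K\<close> makes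
    \<open>K\<close> at least \<open>ln n\<close>.\<close>
  define K where "K = (LEAST K. n < 2 ^ K)"
  have "n < 2 ^ n" by (rule less_exp)
  then have K: "n < 2 ^ K" unfolding K_def by (rule LeastI)
  have lessK: "1 \<le> real n * (1/2) ^ k" if "k < K" for k
  proof -
    have "2 ^ k \<le> n" using not_less_Least[of k "\<lambda>K. n < 2 ^ K"] that by (simp add: K_def)
    then have "real (2 ^ k) \<le> real n" by (simp only: of_nat_le_iff)
    then show ?thesis by (simp add: power_one_over field_simps)
  qed
  have "real n < real (2 ^ K)" using K by (simp only: of_nat_less_iff)
  then have "ln (real n) \<le> ln (2 ^ K)" using n by simp
  also have "\<dots> = real K * ln 2" by (simp add: ln_realpow)
  also have "\<dots> \<le> real K * 1" using ln_2_less_1 by (intro mult_left_mono) auto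
  finally have lnK: "ln (real n) \<le> real K" by simp
  define h where "h k = arc_minorant n ((1/2) ^ k) (1 / (16000 * real n * (1/2) ^ k))" for k
  define F where "F \<theta> = line_measure \<theta> (Proj \<theta> ` ((\<lambda>z. T n z (cis \<theta>)) ` cantor_square n))" for \<theta>
  have int: "integrable lborel (\<lambda>\<theta>. \<Sum>k<K. h k \<theta>)"
    unfolding h_def by (intro Bochner_Integration.integrable_sum integrable_arc_minorant)
  have "ln (real n) / (640000 * real n) \<le> real K * (1 / (640000 * real n))"
    using lnK by (simp add: divide_right_mono)
  also have "\<dots> = (\<Sum>k<K. 1 / (640000 * real n))" by simp
  also have "\<dots> \<le> (\<Sum>k<K. integral\<^sup>L lborel (h k))"
    unfolding h_def by (intro sum_mono integral_arc_minorant_ge lessK) (auto simp: power_le_one)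
  also have "\<dots> = integral\<^sup>L lborel (\<lambda>\<theta>. \<Sum>k<K. h k \<theta>)"
    unfolding h_def by (intro Bochner_Integration.integral_sum[symmetric] integrable_arc_minorant)
  finally have "ennreal (ln (real n) / (640000 * real n)) \<le> ennreal (integral\<^sup>L lborel (\<lambda>\<theta>. \<Sum>k<K. h k \<theta>))"
    by (rule ennreal_leI)
  also have "\<dots> \<le> (\<integral>\<^sup>+ \<theta>. ennreal (\<Sum>k<K. h k \<theta>) \<partial>lborel)"
    by (rule ennreal_integral_le_nn_integral[OF int])
  also have "\<dots> \<le> (\<integral>\<^sup>+ \<theta> \<in> {0..2*pi}. F \<theta> \<partial>lborel)"
  proof (rule nn_integral_mono)
    fix \<theta> :: real
    show "ennreal (\<Sum>k<K. h k \<theta>) \<le> F \<theta> * indicator {0..2*pi} \<theta>"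
    \<comment> \<open>The arcs are disjoint, so at most one summand is nonzero at each angle and the
      sum is still a lower bound for \<open>F\<close>.\<close>
    proof (cases "\<exists>k<K. \<theta> \<in> slope_arc ((1/2) ^ k)")
      case True
      then obtain k where k: "k < K" "\<theta> \<in> slope_arc ((1/2) ^ k)" by auto
      have "h l \<theta> = 0" if "l \<noteq> k" for l
        unfolding h_def using disjoint_slope_arcs[OF k(2), of l] that
        by (intro arc_minorant_eq_0) auto
      then have "(\<Sum>k<K. h k \<theta>) = h k \<theta>"
        using k(1) by (subst sum.remove[of _ k]) auto
      moreover obtain L where "L < (1/4) ^ n" "L-lipschitz_on UNIV (\<lambda>z. T n z (cis \<theta>) - z)"
        using lip[of n \<theta>] n by auto
      then have "ennreal (h k \<theta>) \<le> F \<theta>"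
        unfolding h_def F_def
        by (intro arc_minorant_le_line_measure[OF n _ _ k(2)]) (auto simp: power_le_one)
      moreover have "\<theta> \<in> {0..2*pi}"
      proof -
        have "0 < (1/2 :: real) ^ k" by simp
        then have "0 < tan \<theta>" using slope_arc_tan(2)[OF k(2)] by linarith
        then have "0 < arctan (tan \<theta>)" by simp
        moreover have "arctan (tan \<theta>) < pi / 2" by (rule arctan_ubound)
        ultimately show ?thesis using slope_arc_tan(1)[OF k(2)] pi_gt_zero by auto
      qed
      ultimately show ?thesis by simp
    next
      case False
      then have "(\<Sum>k<K. h k \<theta>) = 0"
        unfolding h_def by (intro sum.neutral ballI arc_minorant_eq_0) auto
      then show ?thesis by simp
    qed
  qed
  finally have "ennreal (ln (real n) / (640000 * real n)) / ennreal (2 * pi) \<le> Fav (T n) (cantor_square n)"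
    unfolding Fav_def F_def by (rule divide_right_mono_ennreal)
  moreover have "ennreal (ln (real n) / (640000 * real n)) / ennreal (2 * pi) =
      ennreal (1 / (640000 * (2 * pi)) * ln (real n) / real n)"
    using n by (subst divide_ennreal) (auto simp: field_simps)
  ultimately show "ennreal (1 / (640000 * (2 * pi)) * ln (real n) / real n) \<le> Fav (T n) (cantor_square n)"
    by simp
qed simp

end
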